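(* Centered random trees are not $\beta$-shape-regular, in the following sense. Let $d\ge2$ and $x\in[0,1]^d$. For any $N\ge d$ and the hyper-rectangle $\mathcal V(x)=\mathcal V(x,(D_i,S_i)_{i=1}^N)$ obtained from a centered random tree after $N$ steps, we have, with probability at least $1/14$, $$\frac{h_+(\mathcal V(x))}{h_-(\mathcal V(x))}\ge2^{\sqrt{N/d}}.$$
   Context: For a hyper-rectangle $A$, $h_-(A)$ and $h_+(A)$ denote its smallest and largest side lengths. A hyper-rectangle is $\beta$-shape-regular if $h_+(A)\le\beta h_-(A)$. Centered random tree, described locally around $x$: $S_i=1/2$ for all $i$ and $D_i$ are i.i.d. uniform on $\{1,\dots,d\}$. Start with the cell $[0,1]^d$. At step $i$, the side of the current cell containing $x$ in direction $D_i$ is split at its midpoint, giving two new cells, and the one containing $x$ is retained. $\mathcal V(x,(D_i,S_i)_{i=1}^N)$ is the cell containing $x$ after $N$ steps. *)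

theory Defs
  imports "HOL-Probability.Probability"
begin

text \<open>
  Hyper-rectangles are products of bounded nonempty intervals, each of which may or may not contain
  its end points; the side in direction \<open>j\<close> therefore is the projection of the set to
  coordinate \<open>j\<close>, and its end points are an infimum and a supremum.
\<close>

definition side_lo :: "(real ^ 'n) set \<Rightarrow> 'n \<Rightarrow> real" where
  "side_lo A j = (INF y\<in>A. y $ j)"

definition side_hi :: "(real ^ 'n) set \<Rightarrow> 'n \<Rightarrow> real" where
  "side_hi A j = (SUP y\<in>A. y $ j)"

definition side_length :: "(real ^ 'n) set \<Rightarrow> 'n \<Rightarrow> real" where
  "side_length A j = side_hi A j - side_lo A j"

definition h_minus :: "(real ^ 'n) set \<Rightarrow> real" where
  "h_minus A = Min (range (side_length A))"

definition h_plus :: "(real ^ 'n) set \<Rightarrow> real" where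
  "h_plus A = Max (range (side_length A))"

definition split_point :: "(real ^ 'n) set \<Rightarrow> 'n \<Rightarrow> real \<Rightarrow> real" where
  "split_point A j s = side_lo A j + s * side_length A j"

text \<open>
  The points on the splitting hyperplane belong to the lower of the two new cells, so that these
  partition \<open>A\<close> and exactly one of them contains \<open>x\<close>.
\<close>

definition lower_cell :: "(real ^ 'n) set \<Rightarrow> 'n \<Rightarrow> real \<Rightarrow> (real ^ 'n) set" where
  "lower_cell A j s = {y \<in> A. y $ j \<le> split_point A j s}"

definition upper_cell :: "(real ^ 'n) set \<Rightarrow> 'n \<Rightarrow> real \<Rightarrow> (real ^ 'n) set" where
  "upper_cell A j s = {y \<in> A. split_point A j s < y $ j}"

text \<open>Step \<open>i\<close>, for \<open>i = 1, 2, \<dots>\<close>, uses \<open>D i\<close> and \<open>S i\<close>; the values at \<open>0\<close> are never used.\<close>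

primrec local_cell ::
  "real ^ 'n \<Rightarrow> (nat \<Rightarrow> 'n) \<Rightarrow> (nat \<Rightarrow> real) \<Rightarrow> nat \<Rightarrow> (real ^ 'n) set" where
  "local_cell x D S 0 = cbox 0 1"
| "local_cell x D S (Suc n) =
    (let A = local_cell x D S n; j = D (Suc n); s = S (Suc n)
     in if x \<in> lower_cell A j s then lower_cell A j s else upper_cell A j s)"

definition centered_random_tree ::
  "'a measure \<Rightarrow> nat \<Rightarrow> (nat \<Rightarrow> 'a \<Rightarrow> 'n::finite) \<Rightarrow> (nat \<Rightarrow> 'a \<Rightarrow> real) \<Rightarrow> bool" where
  "centered_random_tree M N D S \<longleftrightarrow>
     prob_space M \<and>
     prob_space.indep_vars M (\<lambda>_. count_space UNIV) D {1..N} \<and>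
     (\<forall>i\<in>{1..N}. distr M (count_space UNIV) (D i) = uniform_count_measure UNIV) \<and>
     (\<forall>i\<in>{1..N}. \<forall>\<omega>\<in>space M. S i \<omega> = 1 / 2)"

end

theory Submission
  imports Defs
begin

text \<open>
  After \<open>N\<close> steps the side in direction \<open>j\<close> has length \<open>2 powr (- K j)\<close>, where \<open>K j\<close> counts the steps with
  \<open>D i = j\<close>. Fix two directions \<open>a \<noteq> b\<close>, put \<open>W = K a - K b\<close> and \<open>m = N / d\<close>; the ratio of the sides
  is at least \<open>2 powr \<bar>W\<bar>\<close>. As \<open>W\<close> is a sum of independent symmetric steps with values in \<open>{-1, 0, 1}\<close>,
  \<open>E W\<^sup>2 = 2 m\<close> and \<open>E W\<^sup>4 \<le> 2 m + 12 m\<^sup>2 \<le> 14 m\<^sup>2\<close>, and the second moment method (Paley--Zygmund)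
  bounds the probability of \<open>W\<^sup>2 \<ge> m\<close> from below by \<open>m\<^sup>2 / (14 m\<^sup>2)\<close>.
\<close>

section \<open>Geometry of the cells\<close>

text \<open>A cell may contain any part of its boundary, so it is only known to lie between an open
  box and its closure. That suffices: the projection to coordinate \<open>j\<close> lies between the
  open and the closed interval with the same end points, which forces its infimum and
  supremum.\<close>

lemma
  fixes A :: "(real ^ 'n::finite) set" and l u :: "real ^ 'n"
  assumes "\<And>i. l $ i < u $ i" "box l u \<subseteq> A" "A \<subseteq> cbox l u"
  shows side_lo_eq: "side_lo A j = l $ j"
    and side_hi_eq: "side_hi A j = u $ j"
proof -
  define P where "P = (\<lambda>y. y $ j) ` A"
  have sub1: "{l $ j<..<u $ j} \<subseteq> P"
  proof
    fix t assume t: "t \<in> {l $ j<..<u $ j}"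
    \<comment> \<open>A preimage of \<open>t\<close> in the open box: the midpoints of the other
      sides are interior points.\<close>
    define y :: "real ^ 'n" where "y = (\<chi> i. if i = j then t else (l $ i + u $ i) / 2)"
    have "y \<in> box l u"
      using t assms(1) by (auto simp: mem_box_cart y_def field_simps)
    then have "y \<in> A" using assms(2) by blast
    then show "t \<in> P" unfolding P_def by (rule rev_image_eqI) (simp add: y_def)
  qed
  have sub2: "P \<subseteq> {l $ j..u $ j}"
    using assms(3) by (fastforce simp: P_def mem_box_cart)
  have lt: "l $ j < u $ j" by (rule assms)
  then have ne: "P \<noteq> {}" using sub1 by (metis greaterThanLessThan_empty_iff not_le subset_empty)
  have "bdd_below P" "bdd_above P"
    using sub2 by (meson bdd_below_Icc bdd_below_mono bdd_above_Icc bdd_above_mono)+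
  then have "Inf P \<le> l $ j" "u $ j \<le> Sup P"
    using lt cInf_superset_mono[OF _ _ sub1] cSup_subset_mono[OF _ _ sub1] by auto
  moreover have "l $ j \<le> Inf P" "Sup P \<le> u $ j"
    using sub2 ne by (auto intro!: cInf_greatest cSup_least)
  ultimately show "side_lo A j = l $ j" "side_hi A j = u $ j"
    by (simp_all add: side_lo_def side_hi_def P_def)
qed

text \<open>Induction on the steps: a split at the midpoint halves the side in direction
  \<open>D (Suc n)\<close> and leaves the others alone. Both halves have the same side lengths, so
  the invariant survives whichever one is retained. Sandwiching the cell between boxes avoids
  tracking which faces belong to it.\<close>

lemma local_cell_sandwich:
  fixes x :: "real ^ 'n::finite"
  assumes "\<And>i. i \<in> {1..n} \<Longrightarrow> S i = 1 / 2"
  shows "\<exists>l u :: real ^ 'n. box l u \<subseteq> local_cell x D S n \<and> local_cell x D S n \<subseteq> cbox l u \<and>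
           (\<forall>j. u $ j - l $ j = (1 / 2) ^ card {i \<in> {1..n}. D i = j})"
  using assms
proof (induction n)
  case 0
  show ?case
    by (rule exI[of _ 0], rule exI[of _ 1]) (auto simp: box_subset_cbox)
next
  case (Suc n)
  define A where "A = local_cell x D S n"
  define c where "c j = card {i \<in> {1..n}. D i = j}" for j
  have "\<And>i. i \<in> {1..n} \<Longrightarrow> S i = 1 / 2" using Suc.prems by simp
  then obtain l u where lu: "box l u \<subseteq> A" "A \<subseteq> cbox l u"
    and len: "\<And>j. u $ j - l $ j = (1 / 2) ^ c j"
    using Suc.IH unfolding A_def c_def by blast
  have lt: "l $ j < u $ j" for j
    using len[of j] by (metis diff_gt_0_iff_gt half_gt_zero_iff zero_less_one zero_less_power)
  define k where "k = D (Suc n)"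
  define p where "p = (l $ k + u $ k) / 2"
  have p: "split_point A k (1 / 2) = p"
    by (simp add: split_point_def side_length_def side_lo_eq[OF lt lu] side_hi_eq[OF lt lu] p_def
        field_simps)
  \<comment> \<open>The lower half has corners \<open>l\<close> and \<open>u'\<close>, the upper
    half \<open>l'\<close> and \<open>u\<close>.\<close>
  define l' u' where "l' = (\<chi> j. if j = k then p else l $ j)" and "u' = (\<chi> j. if j = k then p else u $ j)"
  have p_bounds: "l $ k < p" "p < u $ k" using lt[of k] by (auto simp: p_def)
  have low: "box l u' \<subseteq> lower_cell A k (1 / 2)" "lower_cell A k (1 / 2) \<subseteq> cbox l u'"
    and up: "box l' u \<subseteq> upper_cell A k (1 / 2)" "upper_cell A k (1 / 2) \<subseteq> cbox l' u"
    using lu p_bounds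
    by (force simp: lower_cell_def upper_cell_def p mem_box_cart subset_iff l'_def u'_def
        split: if_splits)+
  have S: "S (Suc n) = 1 / 2" using Suc.prems by simp
  have "{i \<in> {1..Suc n}. D i = j} =
      (if j = k then insert (Suc n) {i \<in> {1..n}. D i = j} else {i \<in> {1..n}. D i = j})" for j
    by (auto simp: k_def le_Suc_eq)
  then have card: "card {i \<in> {1..Suc n}. D i = j} = (if j = k then Suc (c j) else c j)" for j
    by (simp add: c_def)
  have len': "u' $ j - l $ j = (1 / 2) ^ card {i \<in> {1..Suc n}. D i = j}"
    "u $ j - l' $ j = (1 / 2) ^ card {i \<in> {1..Suc n}. D i = j}" for j
    unfolding card using len[of j] by (auto simp: l'_def u'_def p_def field_simps)
  have cell: "local_cell x D S (Suc n) = lower_cell A k (1 / 2) \<or>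
      local_cell x D S (Suc n) = upper_cell A k (1 / 2)"
    by (simp add: A_def k_def S Let_def)
  then show ?case
  proof
    assume *: "local_cell x D S (Suc n) = lower_cell A k (1 / 2)"
    show ?thesis unfolding * using low len'(1) by blast
  next
    assume *: "local_cell x D S (Suc n) = upper_cell A k (1 / 2)"
    show ?thesis unfolding * using up len'(2) by blast
  qed
qed

lemma side_length_local_cell:
  fixes x :: "real ^ 'n::finite"
  assumes "\<And>i. i \<in> {1..n} \<Longrightarrow> S i = 1 / 2"
  shows "side_length (local_cell x D S n) j = (1 / 2) ^ card {i \<in> {1..n}. D i = j}"
proof -
  obtain l u :: "real ^ 'n" where lu: "box l u \<subseteq> local_cell x D S n" "local_cell x D S n \<subseteq> cbox l u"
    and len: "\<And>j. u $ j - l $ j = (1 / 2) ^ card {i \<in> {1..n}. D i = j}"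
    using local_cell_sandwich[of n S x D] assms by blast
  have lt: "l $ j < u $ j" for j
    using len[of j] by (metis diff_gt_0_iff_gt half_gt_zero_iff zero_less_one zero_less_power)
  show ?thesis
    using len by (simp add: side_length_def side_lo_eq[OF lt lu] side_hi_eq[OF lt lu])
qed

lemma side_ratio_le_h_ratio:
  fixes A :: "(real ^ 'n::finite) set"
  assumes "\<And>j. side_length A j > 0"
  shows "side_length A a / side_length A b \<le> h_plus A / h_minus A"
proof (rule frac_le)
  show "side_length A a \<le> h_plus A" "h_minus A \<le> side_length A b"
    by (simp_all add: h_plus_def h_minus_def)
  have "h_minus A \<in> range (side_length A)"
    unfolding h_minus_def by (rule Min_in) auto
  then show "0 < h_minus A" using assms by auto
  show "0 \<le> h_plus A"
    using \<open>side_length A a \<le> h_plus A\<close> assms[of a] by linarith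
qed

text \<open>The sides in directions \<open>a\<close> and \<open>b\<close> are powers of 1/2 with the
  split counts as exponents, so their quotient is 2 to the difference of the counts. Comparing both
  the quotient and its inverse with the extremal ratio gives the absolute value. The difference is
  written as a sum over the steps because its summands become independent random variables.\<close>

lemma h_ratio_local_cell_ge:
  fixes x :: "real ^ 'n::finite" and D :: "nat \<Rightarrow> 'n"
  assumes "\<And>i. i \<in> {1..n} \<Longrightarrow> S i = 1 / 2"
  shows "2 powr \<bar>\<Sum>i\<in>{1..n}. of_bool (D i = a) - of_bool (D i = b)\<bar>
           \<le> h_plus (local_cell x D S n) / h_minus (local_cell x D S n)"
proof -
  define c where "c j = card {i \<in> {1..n}. D i = j}" for j
  have W: "(\<Sum>i\<in>{1..n}. of_bool (D i = a) - of_bool (D i = b)) = real (c a) - real (c b)"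
    by (simp add: sum_subtractf c_def Int_def)
  have len: "side_length (local_cell x D S n) j = 2 powr - real (c j)" for j
    using side_length_local_cell[of n S x D j] assms
    by (simp add: c_def powr_minus powr_realpow power_one_over inverse_eq_divide)
  have "2 powr (real (c j) - real (c i)) \<le> h_plus (local_cell x D S n) / h_minus (local_cell x D S n)"
    for i j
    using side_ratio_le_h_ratio[of "local_cell x D S n" i j] by (simp add: len flip: powr_diff)
  from this[of a b] this[of b a] show ?thesis
    unfolding W by (cases "c a \<ge> c b") (auto simp: abs_if)
qed

section \<open>Moments\<close>

context prob_space
begin

text \<open>
  Integrate \<open>2 t Y - t\<^sup>2 Y\<^sup>2 \<le> indicator {Y \<ge> 0}\<close>, valid for \<open>t \<ge> 0\<close>, and choose \<open>t = E Y / E Y\<^sup>2\<close>.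
\<close>

lemma second_moment_method:
  fixes Y :: "'a \<Rightarrow> real"
  assumes [measurable]: "random_variable borel Y"
    and int: "integrable M Y" "integrable M (\<lambda>\<omega>. (Y \<omega>)\<^sup>2)"
    and nonneg: "expectation Y \<ge> 0" and pos: "expectation (\<lambda>\<omega>. (Y \<omega>)\<^sup>2) > 0"
  shows "(expectation Y)\<^sup>2 / expectation (\<lambda>\<omega>. (Y \<omega>)\<^sup>2) \<le> prob {\<omega> \<in> space M. Y \<omega> \<ge> 0}"
proof -
  define E2 where "E2 = expectation (\<lambda>\<omega>. (Y \<omega>)\<^sup>2)"
  define t where "t = expectation Y / E2"
  have "E2 > 0" using pos by (simp add: E2_def)
  then have "t \<ge> 0" using nonneg by (simp add: t_def)
  define B where "B = {\<omega> \<in> space M. Y \<omega> \<ge> 0}"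
  have [measurable]: "B \<in> events" unfolding B_def by measurable
  have "expectation (\<lambda>\<omega>. 2 * t * Y \<omega> - t\<^sup>2 * (Y \<omega>)\<^sup>2) \<le> expectation (indicator B)"
  proof (rule integral_mono)
    fix \<omega> assume \<omega>: "\<omega> \<in> space M"
    \<comment> \<open>The completed square gives the bound 1 for every value of \<open>Y\<close>;
      where \<open>Y\<close> is negative, both terms are nonpositive because \<open>t\<close> is
      nonnegative.\<close>
    have "0 \<le> (1 - t * Y \<omega>)\<^sup>2" by simp
    then have "2 * t * Y \<omega> - t\<^sup>2 * (Y \<omega>)\<^sup>2 \<le> 1" by (simp add: power2_eq_square algebra_simps)
    moreover have "2 * t * Y \<omega> - t\<^sup>2 * (Y \<omega>)\<^sup>2 \<le> 0" if "Y \<omega> < 0"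
    proof -
      have "t * Y \<omega> \<le> 0" using that \<open>t \<ge> 0\<close> by (simp add: mult_nonneg_nonpos)
      moreover have "0 \<le> t\<^sup>2 * (Y \<omega>)\<^sup>2" by simp
      ultimately show ?thesis by (simp only: mult.assoc)
    qed
    ultimately show "2 * t * Y \<omega> - t\<^sup>2 * (Y \<omega>)\<^sup>2 \<le> indicator B \<omega>"
      using \<omega> by (auto simp: B_def indicator_def not_le)
  qed (use int in \<open>auto simp: emeasure_eq_measure intro!: integrable_real_indicator\<close>)
  also have "expectation (\<lambda>\<omega>. 2 * t * Y \<omega> - t\<^sup>2 * (Y \<omega>)\<^sup>2) = 2 * t * expectation Y - t\<^sup>2 * E2"
    using int by (simp add: E2_def)
  also have "\<dots> = (expectation Y)\<^sup>2 / E2"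
    using \<open>E2 > 0\<close> by (simp add: t_def power2_eq_square field_simps)
  finally show ?thesis by (simp add: B_def E2_def)
qed

lemma integrable_bounded_power:
  fixes X :: "'a \<Rightarrow> real"
  assumes [measurable]: "random_variable borel X" and "\<And>\<omega>. \<bar>X \<omega>\<bar> \<le> c"
  shows "integrable M (\<lambda>\<omega>. X \<omega> ^ k)"
  by (rule integrable_const_bound[where B = "c ^ k"])
     (use assms(2) in \<open>auto simp: power_abs intro!: power_mono\<close>)

lemma indep_var_power:
  fixes X Y :: "'a \<Rightarrow> real"
  assumes "indep_var borel X borel Y"
  shows "indep_var borel (\<lambda>\<omega>. X \<omega> ^ p) borel (\<lambda>\<omega>. Y \<omega> ^ q)"
  using indep_var_compose[OF assms, of "\<lambda>z. z ^ p" borel "\<lambda>z. z ^ q" borel]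
  by (simp add: o_def)

text \<open>In the expansion of the fourth power, only the terms with all indices equal and those
  with two distinct indices, each occurring twice, have nonzero mean. The latter number 6 for each
  of the n(n-1)/2 pairs, whence the coefficient 3n(n-1). The second moment is proved simultaneously
  since the induction step for the fourth one uses it.\<close>

lemma moments_sum_symmetric:
  fixes X :: "nat \<Rightarrow> 'a \<Rightarrow> real"
  assumes "indep_vars (\<lambda>_. borel) X {1..n}"
    and bound: "\<And>i \<omega>. \<bar>X i \<omega>\<bar> \<le> 1"
    and odd: "\<And>i. i \<in> {1..n} \<Longrightarrow> expectation (X i) = 0"
      "\<And>i. i \<in> {1..n} \<Longrightarrow> expectation (\<lambda>\<omega>. X i \<omega> ^ 3) = 0"
    and even: "\<And>i. i \<in> {1..n} \<Longrightarrow> expectation (\<lambda>\<omega>. X i \<omega> ^ 2) = v"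
      "\<And>i. i \<in> {1..n} \<Longrightarrow> expectation (\<lambda>\<omega>. X i \<omega> ^ 4) = w"
  shows "expectation (\<lambda>\<omega>. (\<Sum>i\<in>{1..n}. X i \<omega>) ^ 2) = n * v \<and>
    expectation (\<lambda>\<omega>. (\<Sum>i\<in>{1..n}. X i \<omega>) ^ 4) = n * w + 3 * n * (real n - 1) * v\<^sup>2"
  using assms(1) odd even
proof (induction n)
  case 0
  then show ?case by simp
next
  case (Suc n)
  define W where "W \<omega> = (\<Sum>i\<in>{1..n}. X i \<omega>)" for \<omega>
  define Z where "Z = X (Suc n)"
  have set: "{1..Suc n} = insert (Suc n) {1..n}" by auto
  have "indep_vars (\<lambda>_. borel) X {1..n}"
    using Suc.prems(1) by (rule indep_vars_subset) auto
  then have IH: "expectation (\<lambda>\<omega>. W \<omega> ^ 2) = n * v"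
    "expectation (\<lambda>\<omega>. W \<omega> ^ 4) = n * w + 3 * n * (real n - 1) * v\<^sup>2"
    using Suc.IH Suc.prems by (auto simp: W_def)
  have Z: "expectation Z = 0" "expectation (\<lambda>\<omega>. Z \<omega> ^ 3) = 0"
    "expectation (\<lambda>\<omega>. Z \<omega> ^ 2) = v" "expectation (\<lambda>\<omega>. Z \<omega> ^ 4) = w"
    using Suc.prems(2-5)[of "Suc n"] by (simp_all add: Z_def)
  have ind: "indep_var borel Z borel W"
    unfolding Z_def W_def using Suc.prems(1) unfolding set
    by (intro indep_vars_sum) auto
  then have [measurable]: "random_variable borel Z" "random_variable borel W"
    by (auto dest: indep_var_rv1 indep_var_rv2)
  have "\<bar>W \<omega>\<bar> \<le> real n" for \<omega>
    using sum_norm_bound[of "{1..n}" "\<lambda>i. X i \<omega>" 1] bound by (simp add: W_def)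
  then have intW: "integrable M (\<lambda>\<omega>. W \<omega> ^ k)" for k
    by (intro integrable_bounded_power) auto
  have intZ: "integrable M (\<lambda>\<omega>. Z \<omega> ^ k)" for k
    by (rule integrable_bounded_power[where c = 1]) (simp, simp add: Z_def bound)
  have int: "integrable M (\<lambda>\<omega>. Z \<omega> ^ p * W \<omega> ^ q)"
    and E: "expectation (\<lambda>\<omega>. Z \<omega> ^ p * W \<omega> ^ q) =
      expectation (\<lambda>\<omega>. Z \<omega> ^ p) * expectation (\<lambda>\<omega>. W \<omega> ^ q)" for p q
    using indep_var_integrable[OF indep_var_power[OF ind] intZ intW]
      indep_var_lebesgue_integral[OF indep_var_power[OF ind] intZ intW] by auto
  \<comment> \<open>The exponents 1 are spelled out so that the mixed terms are instances of
    \<open>int\<close> and \<open>E\<close>.\<close>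
  have "expectation (\<lambda>\<omega>. (W \<omega> + Z \<omega>) ^ 2) = expectation (\<lambda>\<omega>.
      W \<omega> ^ 2 + 2 * (Z \<omega> ^ 1 * W \<omega> ^ 1) + Z \<omega> ^ 2)"
    by (simp add: power2_eq_square algebra_simps)
  also have "\<dots> = Suc n * v"
    using int[of 1 1] intW[of 2] intZ[of 2] E[of 1 1] Z IH
    by (simp add: distrib_right)
  finally have E2: "expectation (\<lambda>\<omega>. (W \<omega> + Z \<omega>) ^ 2) = Suc n * v" .
  have "expectation (\<lambda>\<omega>. (W \<omega> + Z \<omega>) ^ 4) = expectation (\<lambda>\<omega>.
      W \<omega> ^ 4 + 4 * (Z \<omega> ^ 1 * W \<omega> ^ 3) + 6 * (Z \<omega> ^ 2 * W \<omega> ^ 2) + 4 * (Z \<omega> ^ 3 * W \<omega> ^ 1) + Z \<omega> ^ 4)"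
    by (rule Bochner_Integration.integral_cong) (simp_all add: power_numeral_reduce algebra_simps)
  also have "\<dots> = expectation (\<lambda>\<omega>. W \<omega> ^ 4) + 4 * expectation (\<lambda>\<omega>. Z \<omega> ^ 1 * W \<omega> ^ 3)
      + 6 * expectation (\<lambda>\<omega>. Z \<omega> ^ 2 * W \<omega> ^ 2) + 4 * expectation (\<lambda>\<omega>. Z \<omega> ^ 3 * W \<omega> ^ 1)
      + expectation (\<lambda>\<omega>. Z \<omega> ^ 4)"
    using int[of 1 3] int[of 2 2] int[of 3 1] intW[of 4] intZ[of 4] by simp
  \<comment> \<open>The terms with \<open>Z\<close> to the power 1 or 3 vanish; the middle term
    contributes 6 times \<open>v\<close> times the second moment of \<open>W\<close>.\<close>
  also have "\<dots> = n * w + 3 * n * (real n - 1) * v\<^sup>2 + 6 * v * (n * v) + w"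
    unfolding E by (simp add: Z IH)
  also have "\<dots> = Suc n * w + 3 * Suc n * (real (Suc n) - 1) * v\<^sup>2"
    by (simp add: algebra_simps power2_eq_square)
  finally have E4: "expectation (\<lambda>\<omega>. (W \<omega> + Z \<omega>) ^ 4) =
    Suc n * w + 3 * Suc n * (real (Suc n) - 1) * v\<^sup>2" .
  show ?case using E2 E4 by (simp add: W_def Z_def)
qed

end

text \<open>The step is 1 at \<open>a\<close>, -1 at \<open>b\<close> and 0 in the remaining
  directions. Keeping \<open>0 ^ k\<close> covers \<open>k = 0\<close> too; otherwise the value is 0
  for odd and 2/d for even \<open>k\<close>.\<close>

lemma moments_uniform_step:
  fixes a b :: "'n::finite"
  assumes "a \<noteq> b"
  defines "f \<equiv> \<lambda>j. of_bool (j = a) - of_bool (j = b) :: real"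
  shows "integral\<^sup>L (uniform_count_measure UNIV) (\<lambda>j. f j ^ k) =
    (1 ^ k + (- 1) ^ k + (real CARD('n) - 2) * 0 ^ k) / CARD('n)"
proof -
  have "(\<Sum>j\<in>UNIV. f j ^ k) = (\<Sum>j\<in>{a, b}. f j ^ k) + (\<Sum>j\<in>- {a, b}. f j ^ k)"
    by (simp add: Compl_eq_Diff_UNIV add.commute sum.subset_diff[of "{a, b}" UNIV])
  also have "(\<Sum>j\<in>- {a, b}. f j ^ k) = (\<Sum>j\<in>- {a, b}. 0 ^ k)"
    by (rule sum.cong) (auto simp: f_def)
  also have "real (card (- {a, b})) = real CARD('n) - 2"
    using assms(1) card_mono[of UNIV "{a, b}"] by (simp add: Compl_eq_Diff_UNIV card_Diff_subset of_nat_diff)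
  then have "(\<Sum>j\<in>- {a, b}. 0 ^ k) = (real CARD('n) - 2) * 0 ^ k" by simp
  finally show ?thesis
    using assms(1) by (simp add: integral_uniform_count_measure f_def)
qed

section \<open>The second moment method for the difference of two split counts\<close>

theorem proposition29:
  fixes x :: "real ^ 'n" and N :: nat and M :: "'a measure"
    and D :: "nat \<Rightarrow> 'a \<Rightarrow> 'n" and S :: "nat \<Rightarrow> 'a \<Rightarrow> real"
  assumes "CARD('n) \<ge> 2"
    and "x \<in> cbox 0 1"
    and "N \<ge> CARD('n)"
    and "centered_random_tree M N D S"
  defines "V \<equiv> \<lambda>\<omega>. local_cell x (\<lambda>i. D i \<omega>) (\<lambda>i. S i \<omega>) N"
  shows "measure M {\<omega> \<in> space M.
           h_plus (V \<omega>) / h_minus (V \<omega>) \<ge> 2 powr sqrt (real N / real CARD('n))} \<ge> 1 / 14"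
proof -
  interpret prob_space M using assms(4) by (simp add: centered_random_tree_def)
  have indepD: "indep_vars (\<lambda>_. count_space UNIV) D {1..N}"
    and distrD: "\<And>i. i \<in> {1..N} \<Longrightarrow> distr M (count_space UNIV) (D i) = uniform_count_measure UNIV"
    and S: "\<And>i \<omega>. i \<in> {1..N} \<Longrightarrow> \<omega> \<in> space M \<Longrightarrow> S i \<omega> = 1 / 2"
    using assms(4) by (auto simp: centered_random_tree_def)
  obtain a b :: 'n where ab: "a \<noteq> b"
    using assms(1) by (metis card_le_Suc0_iff_eq finite UNIV_I not_less_eq_eq numeral_2_eq_2)
  define d where "d = real CARD('n)"
  define m where "m = N / d"
  have d: "d \<ge> 2" using assms(1) by (simp add: d_def)
  have m: "m \<ge> 1" using assms(3) d by (simp add: m_def d_def)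
  define f where "f = (\<lambda>j. of_bool (j = a) - of_bool (j = b) :: real)"
  define X where "X i \<omega> = f (D i \<omega>)" for i \<omega>
  define W where "W \<omega> = (\<Sum>i\<in>{1..N}. X i \<omega>)" for \<omega>
  have bound: "\<bar>X i \<omega>\<bar> \<le> 1" for i \<omega> by (simp add: X_def f_def)
  have D_meas[measurable]: "D i \<in> M \<rightarrow>\<^sub>M count_space UNIV" if "i \<in> {1..N}" for i
    using indepD that by (auto simp: indep_vars_def2)
  have mom: "expectation (\<lambda>\<omega>. X i \<omega> ^ k) = (1 ^ k + (- 1) ^ k + (d - 2) * 0 ^ k) / d"
    if "i \<in> {1..N}" for i k
    using integral_distr[OF D_meas[OF that], of "\<lambda>j. f j ^ k"] moments_uniform_step[OF ab, of k]
    by (simp add: distrD[OF that] X_def f_def d_def)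
  have indX: "indep_vars (\<lambda>_. borel) X {1..N}"
    unfolding X_def using indepD by (rule indep_vars_compose2) simp
  \<comment> \<open>The second and fourth moments of a step coincide, as its values are -1, 0 and
    1.\<close>
  have EW: "expectation (\<lambda>\<omega>. W \<omega> ^ 2) = N * (2 / d)"
    "expectation (\<lambda>\<omega>. W \<omega> ^ 4) = N * (2 / d) + 3 * N * (real N - 1) * (2 / d)\<^sup>2"
    using moments_sum_symmetric[OF indX bound, of "2 / d" "2 / d"] mom[of _ 1] mom[of _ 2]
      mom[of _ 3] mom[of _ 4] unfolding W_def by simp_all
  have "X i \<in> borel_measurable M" if "i \<in> {1..N}" for i
    using indX that by (auto simp: indep_vars_def2)
  then have [measurable]: "random_variable borel W"
    unfolding W_def by (rule borel_measurable_sum)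
  have "\<bar>W \<omega>\<bar> \<le> real N" for \<omega>
    using sum_norm_bound[of "{1..N}" "\<lambda>i. X i \<omega>" 1] bound by (simp add: W_def)
  then have intW: "integrable M (\<lambda>\<omega>. W \<omega> ^ k)" for k
    by (intro integrable_bounded_power) auto
  \<comment> \<open>Nonnegativity of \<open>Y\<close> means that the absolute value of
    \<open>W\<close> is at least \<open>sqrt m\<close>; the mean of \<open>Y\<close> is 2m - m =
    m.\<close>
  define Y where "Y \<omega> = W \<omega> ^ 2 - m" for \<omega>
  have [measurable]: "random_variable borel Y" unfolding Y_def by measurable
  have Y2: "(Y \<omega>)\<^sup>2 = W \<omega> ^ 4 - 2 * m * W \<omega> ^ 2 + m\<^sup>2" for \<omega>
    by (simp add: Y_def power_numeral_reduce algebra_simps)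
  have intY: "integrable M Y" "integrable M (\<lambda>\<omega>. (Y \<omega>)\<^sup>2)"
    unfolding Y2 using intW by (simp_all add: Y_def[abs_def])
  have EY: "expectation Y = m"
    unfolding Y_def using intW by (simp add: EW m_def prob_space)
  have "expectation (\<lambda>\<omega>. (Y \<omega>)\<^sup>2) = expectation (\<lambda>\<omega>. W \<omega> ^ 4) - 2 * m * (2 * m) + m\<^sup>2"
    unfolding Y2 using intW EW(1) by (simp add: m_def prob_space)
  also have "\<dots> = 2 * m + 9 * m\<^sup>2 - 12 * m / d"
    unfolding EW(2) using d by (simp add: m_def field_simps power2_eq_square)
  finally have EY2: "expectation (\<lambda>\<omega>. (Y \<omega>)\<^sup>2) = 2 * m + 9 * m\<^sup>2 - 12 * m / d" .
  \<comment> \<open>Here \<open>N \<ge> CARD('n)\<close> enters, through \<open>m \<ge> 1\<close>.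
    Above, dropping the negative term leaves at most 11 m^2, within the required 14 m^2. Below, d at
    least 2 leaves at least 9 m^2 - 4 m, which is positive.\<close>
  have "m \<le> m\<^sup>2" using m by (simp add: power2_eq_square)
  have "12 * m / d \<le> 6 * m" using d m by (simp add: field_simps)
  moreover have "0 \<le> 12 * m / d" using d m by simp
  ultimately have EY2_bounds: "0 < expectation (\<lambda>\<omega>. (Y \<omega>)\<^sup>2)"
      "expectation (\<lambda>\<omega>. (Y \<omega>)\<^sup>2) \<le> 14 * m\<^sup>2"
    unfolding EY2 using m \<open>m \<le> m\<^sup>2\<close> by linarith+
  have "1 / 14 = m\<^sup>2 / (14 * m\<^sup>2)" using m by simp
  also have "\<dots> \<le> m\<^sup>2 / expectation (\<lambda>\<omega>. (Y \<omega>)\<^sup>2)"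
    using EY2_bounds m by (intro divide_left_mono) auto
  also have "\<dots> \<le> prob {\<omega> \<in> space M. Y \<omega> \<ge> 0}"
    using second_moment_method[of Y] EY EY2_bounds(1) intY m by simp
  also have "\<dots> \<le> prob {\<omega> \<in> space M. h_plus (V \<omega>) / h_minus (V \<omega>) \<ge> 2 powr sqrt m}"
  proof (rule finite_measure_mono)
    show "{\<omega> \<in> space M. Y \<omega> \<ge> 0} \<subseteq> {\<omega> \<in> space M. h_plus (V \<omega>) / h_minus (V \<omega>) \<ge> 2 powr sqrt m}"
    proof safe
      fix \<omega> assume \<omega>: "\<omega> \<in> space M" and "Y \<omega> \<ge> 0"
      then have "sqrt m \<le> \<bar>W \<omega>\<bar>" by (auto simp: Y_def intro: real_le_lsqrt)
      then have "2 powr sqrt m \<le> 2 powr \<bar>W \<omega>\<bar>" by simp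
      also have "\<dots> \<le> h_plus (V \<omega>) / h_minus (V \<omega>)"
        unfolding V_def W_def X_def f_def using S \<omega> by (intro h_ratio_local_cell_ge) auto
      finally show "2 powr sqrt m \<le> h_plus (V \<omega>) / h_minus (V \<omega>)" .
    qed
    \<comment> \<open>Monotonicity of the measure needs the larger set to be an event. The cell is a
      random set, so its side lengths are rewritten on \<open>space M\<close> as finite products of
      measurable functions of the \<open>D i\<close>.\<close>
    define L where "L j \<omega> = (\<Prod>i\<in>{1..N}. if D i \<omega> = j then 1 / 2 else 1 :: real)" for j \<omega>
    have [measurable]: "random_variable borel (L j)" for j
      unfolding L_def by measurable
    have "side_length (V \<omega>) = (\<lambda>j. L j \<omega>)" if "\<omega> \<in> space M" for \<omega>
    proof
      fix j
      have "side_length (V \<omega>) j = (1 / 2) ^ card {i \<in> {1..N}. D i \<omega> = j}"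
        unfolding V_def by (rule side_length_local_cell) (use S that in auto)
      also have "\<dots> = L j \<omega>"
        by (simp add: L_def flip: prod.inter_filter)
      finally show "side_length (V \<omega>) j = L j \<omega>" .
    qed
    then have "{\<omega> \<in> space M. h_plus (V \<omega>) / h_minus (V \<omega>) \<ge> 2 powr sqrt m} =
        {\<omega> \<in> space M. Max (range (\<lambda>j. L j \<omega>)) / Min (range (\<lambda>j. L j \<omega>)) \<ge> 2 powr sqrt m}"
      by (auto simp: h_plus_def h_minus_def)
    also have "\<dots> \<in> events" by measurable
    finally show "{\<omega> \<in> space M. h_plus (V \<omega>) / h_minus (V \<omega>) \<ge> 2 powr sqrt m} \<in> events" .
  qed
  finally show ?thesis by (simp add: m_def d_def)
qed

end
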